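(* Let $k$ be a positive integer. The following are equivalent: (i) (Szemerédi's theorem for length $k$) Every set $A\subseteq\mathbb{N}$ with $d^*(A)>0$ contains an arithmetic progression of length $k$. (ii) For every counting measure $\mu$ on $\beta\mathbb{N}$, one has $\mu(AP_k)=\mu(\beta\mathbb{N})$.
   Context: $\mathbb{N}=\{0,1,2,\dots\}$, $\mathbb{N}^+=\{1,2,\dots\}$, and $[a,b]$ denotes an interval of natural numbers. An arithmetic progression of length $k$ is a set $\{a,a+b,\dots,a+(k-1)b\}$ with $a,b\in\mathbb{N}$, $b>0$. Upper Banach density: for $A\subseteq\mathbb{N}$, $d^*(A)=\limsup_{N\to\infty}\sup_{M\in\mathbb{N}}\frac{|A\cap[M+1,M+N]|}{N}$. For a discrete set $X$, $\beta X$ is the set of ultrafilters on $X$; $\beta\mathbb{N}$ carries the compact Hausdorff topology whose basic open sets are $\overline{A}=\{p\in\beta\mathbb{N}: A\in p\}$ for $A\subseteq\mathbb{N}$ (these are clopen), and $\mathbb{N}\subseteq\beta\mathbb{N}$ via principal ultrafilters. Likewise $\overline{I}=\{q: I\in q\}$ for $I\subseteq X$. For an ultrafilter $q$ on $X$ and $f:X\to Y$ with $Y$ compact Hausdorff, $\lim_{x\to q}f(x)$ is the unique $y\in Y$ such that $f^{-1}(U)\in q$ for every open neighborhood $U$ of $y$. $AP_k$ is the set of all $p\in\beta\mathbb{N}$ such that every $A\in p$ contains at least one arithmetic progression of length $k$. Counting measure: a measure $\mu$ on $\beta\mathbb{N}$ is called a counting measure if it is a Radon measure and there is an ultrafilter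 $q\in\beta(\mathbb{N}^+\times\mathbb{N})$ such that $$\mu(\overline{A})=\lim_{(N,M)\to q}\frac{|A\cap[M+1,M+N]|}{N}\quad\text{for all }A\subseteq\mathbb{N},$$ where $q$ satisfies: (1) $\lim_{(N,M)\to q}\frac1N=0$; and (2) either the interval starting points are bounded, i.e. $\lim_{(N,M)\to q}M=M_0<\infty$ for some $M_0\in\mathbb{N}$ (equivalently $\{(N,M_0):N\in\mathbb{N}^+\}\in q$), or there is a set $I=\{(N_1,M_1),(N_2,M_2),\dots\}$ of disjoint and growing intervals, meaning $M_i+N_i<M_{i+1}$ and $N_i<N_{i+1}$ for all $i\ge 1$, such that $q\in\overline{I}$. *)

theory Defs
  imports "HOL-Analysis.Analysis"
begin

definition ultrafilter :: "'a filter \<Rightarrow> bool" where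
  "ultrafilter F \<longleftrightarrow>
     F \<noteq> bot \<and> (\<forall>P. eventually P F \<or> eventually (\<lambda>x. \<not> P x) F)"

lemma ultrafilter_principal: "ultrafilter (principal {x})"
  by (auto simp: ultrafilter_def eventually_principal principal_eq_bot_iff)

text \<open>The space of all ultrafilters on a discrete type. The library type of filters
  is used so that limits along ultrafilters are the usual ones; membership \<open>A \<in> p\<close>
  is \<open>eventually (\<lambda>x. x \<in> A) p\<close>.\<close>

typedef 'a beta = "{F :: 'a filter. ultrafilter F}"
  morphisms filter_of Abs_beta
  by (intro exI CollectI) (rule ultrafilter_principal)

definition mem_uf :: "'a set \<Rightarrow> 'a beta \<Rightarrow> bool" where
  "mem_uf A p \<longleftrightarrow> eventually (\<lambda>x. x \<in> A) (filter_of p)"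

definition bar :: "'a set \<Rightarrow> 'a beta set" where
  "bar A = {p. mem_uf A p}"

instantiation beta :: (type) topological_space
begin

definition open_beta :: "'a beta set \<Rightarrow> bool" where
  "open_beta = generate_topology (range bar)"

instance
proof
  show "open (UNIV :: 'a beta set)"
    unfolding open_beta_def by (rule generate_topology.UNIV)
next
  fix S T :: "'a beta set"
  assume "open S" "open T"
  then show "open (S \<inter> T)"
    unfolding open_beta_def by (rule generate_topology.Int)
next
  fix K :: "'a beta set set"
  assume "\<forall>S\<in>K. open S"
  then show "open (\<Union>K)"
    unfolding open_beta_def by (auto intro: generate_topology.UN)
qed

end

lemma open_bar: "open (bar A)"
  unfolding open_beta_def by (rule generate_topology.Basis) simp

lemma bar_Compl: "bar (- A) = - bar A"
proof -
  have "mem_uf (- A) p \<longleftrightarrow> \<not> mem_uf A p" for p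
  proof -
    have uf: "ultrafilter (filter_of p)"
      using filter_of[of p] by simp
    have "False" if "mem_uf A p" "mem_uf (- A) p"
    proof -
      have "eventually (\<lambda>x. x \<in> A \<and> x \<in> - A) (filter_of p)"
        using that unfolding mem_uf_def by (rule eventually_conj)
      with uf show False
        by (simp add: ultrafilter_def trivial_limit_def)
    qed
    moreover have "mem_uf A p \<or> mem_uf (- A) p"
      using uf by (auto simp: ultrafilter_def mem_uf_def)
    ultimately show ?thesis by blast
  qed
  then show ?thesis by (auto simp: bar_def)
qed

instance beta :: (type) t2_space
proof
  fix p q :: "'a beta"
  assume "p \<noteq> q"
  have "\<exists>A. mem_uf A p \<noteq> mem_uf A q"
  proof (rule ccontr)
    assume "\<not> ?thesis"
    then have "mem_uf {x. P x} p = mem_uf {x. P x} q" for P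
      by simp
    then have "eventually P (filter_of p) = eventually P (filter_of q)" for P
      by (simp add: mem_uf_def)
    then have "filter_of p = filter_of q"
      by (simp add: filter_eq_iff)
    with \<open>p \<noteq> q\<close> show False
      by (simp add: filter_of_inject)
  qed
  then obtain A where "mem_uf A p \<noteq> mem_uf A q" by blast
  then obtain B where "p \<in> bar B" "q \<in> bar (- B)"
  proof (cases "mem_uf A p")
    case True
    with \<open>mem_uf A p \<noteq> mem_uf A q\<close> have "p \<in> bar A" "q \<in> bar (- A)"
      by (simp_all add: bar_Compl) (simp_all add: bar_def)
    then show ?thesis by (rule that)
  next
    case False
    with \<open>mem_uf A p \<noteq> mem_uf A q\<close> have "p \<in> bar (- A)" "q \<in> bar (- (- A))"
      by (simp_all add: bar_Compl) (simp_all add: bar_def)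
    then show ?thesis by (rule that)
  qed
  moreover have "bar B \<inter> bar (- B) = {}"
    by (simp add: bar_Compl)
  ultimately show "\<exists>U V. open U \<and> open V \<and> p \<in> U \<and> q \<in> V \<and> U \<inter> V = {}"
    using open_bar by blast
qed

definition arith_prog :: "nat \<Rightarrow> nat set \<Rightarrow> bool" where
  "arith_prog k S \<longleftrightarrow> (\<exists>a b. b > 0 \<and> S = {a + i * b | i. i < k})"

definition contains_arith_prog :: "nat \<Rightarrow> nat set \<Rightarrow> bool" where
  "contains_arith_prog k A \<longleftrightarrow> (\<exists>S. arith_prog k S \<and> S \<subseteq> A)"

definition AP :: "nat \<Rightarrow> nat beta set" where
  "AP k = {p. \<forall>A. mem_uf A p \<longrightarrow> contains_arith_prog k A}"

text \<open>\<open>emeasure\<close> is \<open>0\<close> by convention on non-measurable sets; \<open>AP k\<close> is closed, hence Borel.\<close>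

lemma closed_AP: "closed (AP k)"
proof -
  have "- AP k = (\<Union>A\<in>{A. \<not> contains_arith_prog k A}. bar A)"
    by (auto simp: AP_def bar_def)
  then show ?thesis
    unfolding closed_def using open_bar by auto
qed

lemma AP_in_borel: "AP k \<in> sets borel"
  by (intro borel_closed closed_AP)

definition window_density :: "nat set \<Rightarrow> nat \<Rightarrow> nat \<Rightarrow> real" where
  "window_density A N M = real (card (A \<inter> {M + 1..M + N})) / real N"

definition upper_banach_density :: "nat set \<Rightarrow> ereal" where
  "upper_banach_density A = limsup (\<lambda>N. SUP M. ereal (window_density A N M))"

definition radon_measure :: "'a::t2_space measure \<Rightarrow> bool" where
  "radon_measure \<mu> \<longleftrightarrow>
     sets \<mu> = sets borel \<and>
     (\<forall>x. \<exists>U. open U \<and> x \<in> U \<and> emeasure \<mu> U < \<infinity>) \<and>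
     (\<forall>B\<in>sets borel. emeasure \<mu> B = (SUP K\<in>{K. compact K \<and> K \<subseteq> B}. emeasure \<mu> K))"

definition disjoint_growing :: "(nat \<times> nat) set \<Rightarrow> bool" where
  "disjoint_growing I \<longleftrightarrow>
     (\<exists>N M :: nat \<Rightarrow> nat. I = range (\<lambda>i. (N i, M i)) \<and>
        (\<forall>i. 0 < N i \<and> M i + N i < M (Suc i) \<and> N i < N (Suc i)))"

text \<open>An ultrafilter on \<open>\<nat>\<^sup>+ \<times> \<nat>\<close> is represented as an ultrafilter on \<open>\<nat> \<times> \<nat>\<close> that contains
  \<open>\<nat>\<^sup>+ \<times> \<nat>\<close>. This has to be required explicitly, because \<open>1 / 0 = 0\<close> here. Convergence of \<open>M\<close>
  refers to the discrete topology on the natural numbers.\<close>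

definition counting_ultrafilter :: "(nat \<times> nat) beta \<Rightarrow> bool" where
  "counting_ultrafilter q \<longleftrightarrow>
     mem_uf {(N, M). N > 0} q \<and>
     ((\<lambda>(N, M). 1 / real N) \<longlongrightarrow> 0) (filter_of q) \<and>
     ((\<exists>M\<^sub>0. ((\<lambda>(N, M). M) \<longlongrightarrow> M\<^sub>0) (filter_of q)) \<or>
      (\<exists>I. disjoint_growing I \<and> q \<in> bar I))"

definition counting_measure :: "nat beta measure \<Rightarrow> bool" where
  "counting_measure \<mu> \<longleftrightarrow>
     radon_measure \<mu> \<and>
     (\<exists>q. counting_ultrafilter q \<and>
        (\<forall>A. ((\<lambda>(N, M). ennreal (window_density A N M)) \<longlongrightarrow> emeasure \<mu> (bar A)) (filter_of q)))"

end

theory Submission imports Defs begin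

text \<open>
  The complement of \<^term>\<open>AP k\<close> is the union of the clopen sets \<^term>\<open>bar A\<close> over all \<open>A\<close>
  without an arithmetic progression of length \<open>k\<close>. A counting measure gives \<^term>\<open>bar A\<close> a limit
  of densities of \<open>A\<close> in ever longer windows as its mass, so both directions compare \<open>d\<^sup>*(A)\<close>
  with these masses.

  If Szemeredi's theorem holds for \<open>k\<close>, every such \<open>A\<close> has \<open>d\<^sup>*(A) = 0\<close>, so each of these clopen
  sets is null (\<open>window_density_tendsto_0\<close>). Their union is usually uncountable, but a compact
  subset of it lies in finitely many of them, and inner regularity makes the union null
  (\<open>radon_measure_UN_null\<close>).

  Conversely, let \<open>d\<^sup>*(A) > c > 0\<close>. There are disjoint windows of growing length in which \<open>A\<close> has
  density at least \<open>c / 2\<close> (\<open>ex_disjoint_growing_dense_windows\<close>). Along an ultrafilter that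
  contains the tails of this sequence, the densities of all subsets of \<open>\<nat>\<close> converge, and their limits
  come from a finite Radon measure \<open>\<mu>\<close> (\<open>ex_radon_measure_window_density\<close>). Then
  \<^term>\<open>bar A\<close> has positive mass. If \<^term>\<open>AP k\<close> has full mass, the two sets meet, and
  any ultrafilter in both shows that \<open>A\<close> contains a progression.

  The existence of \<open>\<mu>\<close> is the main construction. The limits define a finitely additive content on
  clopen sets. The \<open>\<sigma>\<close>-algebra that the clopen sets generate is smaller than the Borel
  \<open>\<sigma>\<close>-algebra, so extending the content to it is not enough. Instead, an open set is measured
  from within by clopen sets and any set from outside by open sets. Compactness of the space of
  ultrafilters makes the result countably subadditive (\<open>inner_countably_subadditive\<close>), and open
  sets satisfy the Caratheodory condition (\<open>outer_split_open\<close>).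
\<close>

section \<open>Ultrafilters\<close>

lemma ultrafilter_filter_of: "ultrafilter (filter_of p)"
  using filter_of[of p] by simp

lemma filter_of_neq_bot: "filter_of p \<noteq> bot"
  using ultrafilter_filter_of[of p] by (simp add: ultrafilter_def)

text \<open>A minimal proper filter below \<open>F\<close> decides every predicate \<open>P\<close>, for otherwise it could be
  refined by \<open>P\<close>. Minimal ones exist by Zorn's lemma, because the infimum of a chain of proper
  filters is proper.\<close>

lemma ultrafilter_below:
  assumes "F \<noteq> (bot :: 'a filter)"
  obtains p :: "'a beta" where "filter_of p \<le> F"
proof -
  let ?A = "{G. G \<noteq> bot \<and> G \<le> F}"
  have "\<exists>m\<in>?A. \<forall>a\<in>?A. m \<ge> a \<longrightarrow> a = m"
  proof (rule predicate_Zorn)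
    show "partial_order_on ?A (relation_of (\<ge>) ?A)"
      by (rule partial_order_on_relation_ofI) auto
  next
    fix C assume "C \<in> Chains (relation_of (\<ge>) ?A)"
    then have sub: "C \<subseteq> ?A" and ch: "\<And>G H. G \<in> C \<Longrightarrow> H \<in> C \<Longrightarrow> G \<le> H \<or> H \<le> G"
      by (auto simp: Chains_def relation_of_def)
    show "\<exists>u\<in>?A. \<forall>a\<in>C. a \<ge> u"
    proof (cases "C = {}")
      case True
      then show ?thesis using assms by auto
    next
      case False
      have "eventually (\<lambda>_. False) (Inf C) \<longleftrightarrow> (\<exists>b\<in>C. eventually (\<lambda>_. False) b)"
        using False
      proof (rule eventually_Inf_base)
        fix G H assume "G \<in> C" "H \<in> C"
        with ch[of G H] show "\<exists>x\<in>C. x \<le> inf G H"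
          by (auto intro: bexI[of _ G] bexI[of _ H])
      qed
      then have "Inf C \<noteq> bot"
        using sub by (auto simp: trivial_limit_def)
      moreover have "Inf C \<le> F"
        using False sub by (auto intro: Inf_lower2)
      ultimately show ?thesis by (auto intro: Inf_lower)
    qed
  qed
  then obtain m where m: "m \<noteq> bot" "m \<le> F"
    and min: "\<And>G. G \<noteq> bot \<Longrightarrow> G \<le> F \<Longrightarrow> G \<le> m \<Longrightarrow> G = m" by auto
  have "ultrafilter m"
    unfolding ultrafilter_def
  proof (intro conjI allI m(1))
    fix P
    show "eventually P m \<or> eventually (\<lambda>x. \<not> P x) m"
    proof (cases "inf m (principal {x. P x}) = bot")
      case True
      then show ?thesis by (simp add: trivial_limit_def eventually_inf_principal)
    next
      case False
      then have "inf m (principal {x. P x}) = m"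
        using m(2) by (intro min) (auto intro: le_infI1)
      then have "m \<le> principal {x. P x}" by (simp add: inf.absorb_iff1)
      then show ?thesis by (simp add: le_principal)
    qed
  qed
  then have "filter_of (Abs_beta m) \<le> F"
    using m(2) by (simp add: Abs_beta_inverse)
  then show thesis by (rule that)
qed

lemma ultrafilter_filtermap:
  assumes "ultrafilter F"
  shows "ultrafilter (filtermap f F)"
  using assms by (auto simp: ultrafilter_def filtermap_bot_iff eventually_filtermap)

text \<open>Used with a neighbourhood filter for \<open>G\<close>: an ultrafilter converges to each of its
  cluster points.\<close>

lemma ultrafilter_le_if_inf_neq_bot:
  assumes U: "ultrafilter F" and ne: "inf G F \<noteq> bot"
  shows "F \<le> G"
proof (rule filter_leI)
  fix P assume P: "eventually P G"
  show "eventually P F"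
  proof (rule ccontr)
    assume "\<not> eventually P F"
    then have "eventually (\<lambda>x. \<not> P x) F" using U by (auto simp: ultrafilter_def)
    with P have "eventually (\<lambda>_. False) (inf G F)"
      unfolding eventually_inf by blast
    with ne show False by (simp add: trivial_limit_def)
  qed
qed

lemma compact_tendsto_along_ultrafilter:
  assumes K: "compact K" and f: "\<And>x. f x \<in> K"
  shows "\<exists>l\<in>K. (f \<longlongrightarrow> l) (filter_of q)"
proof -
  have U: "ultrafilter (filtermap f (filter_of q))"
    by (rule ultrafilter_filtermap[OF ultrafilter_filter_of])
  then have "filtermap f (filter_of q) \<noteq> bot" by (simp add: ultrafilter_def)
  moreover have "eventually (\<lambda>x. x \<in> K) (filtermap f (filter_of q))"
    using f by (simp add: eventually_filtermap)
  ultimately obtain l where "l \<in> K" "inf (nhds l) (filtermap f (filter_of q)) \<noteq> bot"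
    using K unfolding compact_filter by blast
  with ultrafilter_le_if_inf_neq_bot[OF U] show ?thesis
    by (auto simp: filterlim_def)
qed

section \<open>The compact space of ultrafilters\<close>

lemma bar_Int: "bar (A \<inter> B) = bar A \<inter> bar B"
  by (auto simp: bar_def mem_uf_def eventually_conj_iff)

lemma bar_Un: "bar (A \<union> B) = bar A \<union> bar B"
proof -
  have "- bar (A \<union> B) = - (bar A \<union> bar B)"
    using bar_Int[of "- A" "- B"] by (simp add: bar_Compl[symmetric])
  then show ?thesis by (simp only: double_compl compl_eq_compl_iff)
qed

lemma bar_empty: "bar {} = {}"
  using filter_of_neq_bot by (auto simp: bar_def mem_uf_def trivial_limit_def)

lemma bar_UNIV: "bar UNIV = UNIV"
  by (auto simp: bar_def mem_uf_def)

lemma bar_UN_finite: "finite I \<Longrightarrow> bar (\<Union>i\<in>I. A i) = (\<Union>i\<in>I. bar (A i))"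
  by (induction I rule: finite_induct) (simp_all add: bar_empty bar_Un)

text \<open>Principal ultrafilters separate the subsets of the discrete space.\<close>

lemma bar_subset_iff: "bar A \<subseteq> bar B \<longleftrightarrow> A \<subseteq> B"
proof
  assume *: "bar A \<subseteq> bar B"
  show "A \<subseteq> B"
  proof
    fix x assume "x \<in> A"
    let ?p = "Abs_beta (principal {x})"
    have "?p \<in> bar C \<longleftrightarrow> x \<in> C" for C
      by (simp add: bar_def mem_uf_def Abs_beta_inverse ultrafilter_principal eventually_principal)
    with * \<open>x \<in> A\<close> show "x \<in> B" by blast
  qed
qed (auto simp: bar_def mem_uf_def elim: eventually_mono)

lemma bar_neighbourhood:
  assumes "open U" "p \<in> U"
  obtains A where "p \<in> bar A" "bar A \<subseteq> U"
proof -
  from assms(1) have "generate_topology (range bar) U" by (simp add: open_beta_def)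
  then have "p \<in> U \<longrightarrow> (\<exists>A. p \<in> bar A \<and> bar A \<subseteq> U)"
  proof induction
    case UNIV
    then show ?case by (auto simp: bar_UNIV intro: exI[of _ UNIV])
  next
    case (Int a b)
    then show ?case by (metis IntE IntI bar_Int inf_mono)
  next
    case (UN K)
    then show ?case by blast
  next
    case (Basis s)
    then show ?case by blast
  qed
  with assms(2) that show thesis by blast
qed

text \<open>Refine a given proper filter \<open>F\<close> on the space of ultrafilters to an ultrafilter \<open>G\<close>. The sets
  \<open>A\<close> with \<open>bar A\<close> large for \<open>G\<close> form an ultrafilter \<open>p\<close>, and \<open>G\<close> converges to \<open>p\<close>
  by construction.\<close>

lemma compact_UNIV_beta: "compact (UNIV :: 'a beta set)"
  unfolding compact_filter
proof (intro allI impI)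
  fix F :: "'a beta filter"
  assume "F \<noteq> bot"
  then obtain G where G: "filter_of G \<le> F" by (rule ultrafilter_below)
  define p where "p = Abs_filter (\<lambda>P. eventually (\<lambda>r. r \<in> bar {x. P x}) (filter_of G))"
  have "is_filter (\<lambda>P. eventually (\<lambda>r. r \<in> bar {x. P x}) (filter_of G))"
  proof
    show "\<forall>\<^sub>F r in filter_of G. r \<in> bar {x. True}" by (simp add: bar_UNIV)
  next
    fix P Q
    assume "\<forall>\<^sub>F r in filter_of G. r \<in> bar {x. P x}" "\<forall>\<^sub>F r in filter_of G. r \<in> bar {x. Q x}"
    then show "\<forall>\<^sub>F r in filter_of G. r \<in> bar {x. P x \<and> Q x}"
      by (simp add: Collect_conj_eq bar_Int eventually_conj)
  next
    fix P Q :: "'a \<Rightarrow> bool"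
    assume "\<forall>x. P x \<longrightarrow> Q x" and P: "\<forall>\<^sub>F r in filter_of G. r \<in> bar {x. P x}"
    then have "bar {x. P x} \<subseteq> bar {x. Q x}" by (simp add: bar_subset_iff Collect_mono)
    with P show "\<forall>\<^sub>F r in filter_of G. r \<in> bar {x. Q x}"
      by (auto elim: eventually_mono)
  qed
  then have ev: "eventually P p \<longleftrightarrow> (\<forall>\<^sub>F r in filter_of G. r \<in> bar {x. P x})" for P
    unfolding p_def by (rule eventually_Abs_filter)
  have "ultrafilter p"
    unfolding ultrafilter_def
  proof (intro conjI allI)
    show "p \<noteq> bot"
      using filter_of_neq_bot[of G] by (simp add: trivial_limit_def ev bar_empty)
  next
    fix P :: "'a \<Rightarrow> bool"
    have "{x. \<not> P x} = - {x. P x}" by auto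
    then show "eventually P p \<or> eventually (\<lambda>x. \<not> P x) p"
      using ultrafilter_filter_of[of G] by (simp add: ev bar_Compl ultrafilter_def)
  qed
  then have p: "filter_of (Abs_beta p) = p" by (simp add: Abs_beta_inverse)
  have "filter_of G \<le> nhds (Abs_beta p)"
  proof (rule filter_leI)
    fix P assume "eventually P (nhds (Abs_beta p))"
    then obtain S where S: "open S" "Abs_beta p \<in> S" "\<And>r. r \<in> S \<Longrightarrow> P r"
      by (auto simp: eventually_nhds)
    then obtain A where A: "Abs_beta p \<in> bar A" "bar A \<subseteq> S"
      by (auto elim: bar_neighbourhood)
    then have "\<forall>\<^sub>F r in filter_of G. r \<in> bar A"
      by (simp add: bar_def[of A] mem_uf_def p ev)
    then show "eventually P (filter_of G)"
      by eventually_elim (use A S in blast)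
  qed
  then have "filter_of G \<le> inf (nhds (Abs_beta p)) F" using G by simp
  then have "inf (nhds (Abs_beta p)) F \<noteq> bot"
    using filter_of_neq_bot[of G] by (metis bot_unique)
  then show "\<exists>x\<in>UNIV. inf (nhds x) F \<noteq> bot" by blast
qed

lemma closed_imp_compact_beta: "closed (K :: 'a beta set) \<Longrightarrow> compact K"
  using closed_Int_compact[OF _ compact_UNIV_beta] by simp

lemma compact_bar: "compact (bar A)"
  by (intro closed_imp_compact_beta) (simp add: closed_def bar_Compl[symmetric] open_bar)

section \<open>Radon extension of a finitely additive set function\<close>

text \<open>Since \<open>bar\<close> embeds the subsets of the discrete space as an algebra of clopen sets, \<open>m A\<close> can be
  read as the mass of \<^term>\<open>bar A\<close>.\<close>

locale finite_content =
  fixes m :: "'a set \<Rightarrow> ennreal"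
  assumes additive: "A \<inter> B = {} \<Longrightarrow> m (A \<union> B) = m A + m B"
    and finite_UNIV: "m UNIV \<noteq> top"
begin

lemma m_mono: "A \<subseteq> B \<Longrightarrow> m A \<le> m B"
  using additive[of A "B - A"] by (simp add: Un_absorb1)

lemma m_finite: "m A \<noteq> top"
  using m_mono[of A UNIV] finite_UNIV by (auto simp: top_unique)

lemma m_empty: "m {} = 0"
  using additive[of "{}" "{}"] m_finite[of "{}"] by (simp add: ennreal_add_left_cancel)

lemma m_subadditive: "m (A \<union> B) \<le> m A + m B"
proof -
  have "m (A \<union> B) = m A + m (B - A)"
    using additive[of A "B - A"] by simp
  also have "\<dots> \<le> m A + m B"
    by (intro add_left_mono m_mono) auto
  finally show ?thesis .
qed

lemma m_subadditive_UN: "finite I \<Longrightarrow> m (\<Union>i\<in>I. A i) \<le> (\<Sum>i\<in>I. m (A i))"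
proof (induction I rule: finite_induct)
  case (insert i I)
  have "m (A i \<union> (\<Union>j\<in>I. A j)) \<le> m (A i) + m (\<Union>j\<in>I. A j)"
    by (rule m_subadditive)
  also have "\<dots> \<le> m (A i) + (\<Sum>j\<in>I. m (A j))"
    by (intro add_left_mono insert.IH)
  finally show ?case using insert by simp
qed (simp add: m_empty)

definition inner :: "'a beta set \<Rightarrow> ennreal" where
  "inner U = (SUP A\<in>{A. bar A \<subseteq> U}. m A)"

definition outer :: "'a beta set \<Rightarrow> ennreal" where
  "outer S = (INF U\<in>{U. open U \<and> S \<subseteq> U}. inner U)"

lemma inner_upper: "bar A \<subseteq> U \<Longrightarrow> m A \<le> inner U"
  unfolding inner_def by (rule SUP_upper) simp

lemma inner_mono: "U \<subseteq> V \<Longrightarrow> inner U \<le> inner V"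
  unfolding inner_def by (rule SUP_subset_mono) auto

lemma inner_bar: "inner (bar A) = m A"
  unfolding inner_def
  by (intro antisym SUP_least SUP_upper) (auto simp: bar_subset_iff intro: m_mono)

text \<open>A clopen subset of a countable union of open sets is, by compactness, covered by finitely
  many clopen sets that each lie in one of the open sets; group these by the open set they
  lie in.\<close>

lemma inner_countably_subadditive:
  fixes U :: "nat \<Rightarrow> 'a beta set"
  assumes op: "\<And>n. open (U n)"
  shows "inner (\<Union>n. U n) \<le> (\<Sum>n. inner (U n))"
  unfolding inner_def[of "\<Union>n. U n"]
proof (rule SUP_least, clarify)
  fix A assume A: "bar A \<subseteq> (\<Union>n. U n)"
  let ?C = "{(B, n). bar B \<subseteq> U n}"
  have "bar A \<subseteq> (\<Union>c\<in>?C. bar (fst c))"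
  proof
    fix p assume "p \<in> bar A"
    with A obtain n where "p \<in> U n" by auto
    then obtain B where "p \<in> bar B" "bar B \<subseteq> U n" by (rule bar_neighbourhood[OF op])
    then show "p \<in> (\<Union>c\<in>?C. bar (fst c))" by (intro UN_I[of "(B, n)"]) auto
  qed
  then obtain D where D: "D \<subseteq> ?C" "finite D" "bar A \<subseteq> (\<Union>c\<in>D. bar (fst c))"
    by (rule compactE_image[OF compact_bar open_bar])
  define E where "E n = (\<Union>c\<in>{c\<in>D. snd c = n}. fst c)" for n
  have E: "bar (E n) \<subseteq> U n" for n
    unfolding E_def using D(1,2) by (subst bar_UN_finite) fastforce+
  have "bar A \<subseteq> bar (\<Union>n\<in>snd ` D. E n)"
    using D(3,2) by (simp add: bar_UN_finite E_def) blast
  then have "m A \<le> m (\<Union>n\<in>snd ` D. E n)" by (simp only: bar_subset_iff m_mono)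
  also have "\<dots> \<le> (\<Sum>n\<in>snd ` D. m (E n))" using D(2) by (intro m_subadditive_UN) simp
  also have "\<dots> \<le> (\<Sum>n\<in>snd ` D. inner (U n))" by (intro sum_mono inner_upper E)
  also have "\<dots> \<le> (\<Sum>n. inner (U n))" using D(2) by (intro sum_le_suminf) auto
  finally show "m A \<le> (\<Sum>n. inner (U n))" .
qed

lemma outer_lower: "open U \<Longrightarrow> S \<subseteq> U \<Longrightarrow> outer S \<le> inner U"
  unfolding outer_def by (rule INF_lower) simp

lemma outer_mono: "S \<subseteq> T \<Longrightarrow> outer S \<le> outer T"
  unfolding outer_def by (rule INF_superset_mono) auto

lemma outer_open: "open U \<Longrightarrow> outer U = inner U"
  by (intro antisym outer_lower) (auto simp: outer_def intro: INF_greatest inner_mono)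

lemma outer_finite: "outer S \<noteq> top"
  using outer_lower[of UNIV S] inner_bar[of UNIV] m_finite[of UNIV]
  by (auto simp: bar_UNIV top_unique)

lemma outer_approx:
  assumes "0 < (e :: real)"
  obtains U where "open U" "S \<subseteq> U" "inner U \<le> outer S + ennreal e"
proof -
  have "outer S < outer S + ennreal e"
    using assms outer_finite[of S] by (simp add: ennreal_add_left_cancel_less less_top)
  then obtain U where "open U" "S \<subseteq> U" "inner U < outer S + ennreal e"
    unfolding outer_def[of S] INF_less_iff by auto
  with that show thesis by (simp add: less_imp_le)
qed

lemma outer_countably_subadditive:
  fixes S :: "nat \<Rightarrow> 'a beta set"
  shows "outer (\<Union>n. S n) \<le> (\<Sum>n. outer (S n))"
proof (rule ennreal_le_epsilon)
  fix e :: real assume e: "0 < e"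
  have "\<exists>U. open U \<and> S n \<subseteq> U \<and> inner U \<le> outer (S n) + ennreal (e * (1/2) ^ Suc n)" for n
    by (rule outer_approx[of "e * (1/2) ^ Suc n" "S n"]) (use e in auto)
  then obtain U where U: "\<And>n. open (U n)" "\<And>n. S n \<subseteq> U n"
    "\<And>n. inner (U n) \<le> outer (S n) + ennreal (e * (1/2) ^ Suc n)"
    by metis
  have "outer (\<Union>n. S n) \<le> inner (\<Union>n. U n)"
    using U by (intro outer_lower) (auto intro: open_UN)
  also have "\<dots> \<le> (\<Sum>n. inner (U n))"
    by (rule inner_countably_subadditive[OF U(1)])
  also have "\<dots> \<le> (\<Sum>n. outer (S n) + ennreal (e * (1/2) ^ Suc n))"
    by (intro suminf_le U(3)) auto
  also have "\<dots> = (\<Sum>n. outer (S n)) + (\<Sum>n. ennreal (e * (1/2) ^ Suc n))"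
    by (rule suminf_add[symmetric]) auto
  also have "(\<Sum>n. ennreal (e * (1/2) ^ Suc n)) = ennreal e"
    using e sums_mult[OF power_half_series, of e]
    by (intro suminf_ennreal_eq) auto
  finally show "outer (\<Union>n. S n) \<le> (\<Sum>n. outer (S n)) + ennreal e" .
qed

lemma outer_measure_space_outer: "outer_measure_space (Pow UNIV) outer"
proof -
  have "outer {} = 0"
    using outer_open[of "{}"] inner_bar[of "{}"] by (simp add: bar_empty m_empty)
  then show ?thesis
    by (auto simp: outer_measure_space_def positive_def increasing_def countably_subadditive_def
        intro: outer_mono outer_countably_subadditive)
qed

lemma outer_subadditive: "outer (S \<union> T) \<le> outer S + outer T"
proof -
  have pos: "positive (Pow UNIV) outer" and csa: "countably_subadditive (Pow UNIV) outer"
    using outer_measure_space_outer by (auto simp: outer_measure_space_def)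
  interpret algebra UNIV "Pow (UNIV :: 'a beta set)" by (rule algebra_Pow)
  have "outer (S \<union> (T - S)) \<le> outer S + outer (T - S)"
    using countably_subadditive_subadditive[OF pos csa, unfolded subadditive_def,
        rule_format, of S "T - S"]
    by auto
  also have "\<dots> \<le> outer S + outer T" by (intro add_left_mono outer_mono) auto
  finally show ?thesis by simp
qed

text \<open>Inside an open set \<open>V\<close>, cut out a clopen piece \<open>bar A\<close> of \<open>V \<inter> U\<close>. As \<open>bar A\<close> is
  also closed, the rest of \<open>V\<close> is open, and \<open>m\<close> adds over \<open>A\<close> and any clopen piece of
  the rest.\<close>

lemma outer_split_open:
  assumes "open V" "open U"
  shows "outer (V \<inter> U) + outer (V - U) \<le> inner V"
proof -
  have ne: "{A. bar A \<subseteq> W} \<noteq> {}" for W :: "'a beta set"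
  proof -
    have "{} \<in> {A. bar A \<subseteq> W}" by (simp add: bar_empty)
    then show ?thesis by blast
  qed
  have "m A + outer (V - U) \<le> inner V" if A: "bar A \<subseteq> V \<inter> U" for A
  proof -
    let ?R = "V \<inter> bar (- A)"
    have "open ?R" using assms(1) by (intro open_Int open_bar)
    moreover have "V - U \<subseteq> ?R" using A by (auto simp: bar_Compl)
    ultimately have "m A + outer (V - U) \<le> m A + inner ?R"
      by (intro add_left_mono outer_lower)
    also have "\<dots> = (SUP B\<in>{B. bar B \<subseteq> ?R}. m A + m B)"
      unfolding inner_def by (rule ennreal_SUP_add_right[OF ne])
    also have "\<dots> \<le> inner V"
    proof (rule SUP_least, clarify)
      fix B assume B: "bar B \<subseteq> ?R"
      then have "B \<subseteq> - A" by (simp add: bar_subset_iff)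
      then have "m A + m B = m (A \<union> B)" by (intro additive[symmetric]) auto
      also have "\<dots> \<le> inner V" using A B by (intro inner_upper) (auto simp: bar_Un)
      finally show "m A + m B \<le> inner V" .
    qed
    finally show ?thesis .
  qed
  moreover have "outer (V \<inter> U) + outer (V - U) = (SUP A\<in>{A. bar A \<subseteq> V \<inter> U}. m A + outer (V - U))"
    unfolding outer_open[OF open_Int[OF assms]] inner_def[of "V \<inter> U"]
    by (rule ennreal_SUP_add_left[OF ne, symmetric])
  ultimately show ?thesis by (auto intro: SUP_least)
qed

lemma open_in_lambda_system:
  assumes "open U"
  shows "U \<in> lambda_system UNIV (Pow UNIV) outer"
proof -
  interpret algebra UNIV "Pow (UNIV :: 'a beta set)" by (rule algebra_Pow)
  have "outer (S \<inter> U) + outer (S - U) \<le> outer S" for S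
    unfolding outer_def[of S]
  proof (rule INF_greatest, clarify)
    fix V assume V: "open V" "S \<subseteq> V"
    have "outer (S \<inter> U) + outer (S - U) \<le> outer (V \<inter> U) + outer (V - U)"
      using V by (intro add_mono outer_mono) auto
    also have "\<dots> \<le> inner V" using V(1) assms by (rule outer_split_open)
    finally show "outer (S \<inter> U) + outer (S - U) \<le> inner V" .
  qed
  moreover have "outer S \<le> outer (S \<inter> U) + outer (S - U)" for S
    using outer_subadditive[of "S \<inter> U" "S - U"] by (simp add: Int_Diff_Un)
  ultimately show ?thesis by (simp add: lambda_system_eq antisym del: Pow_UNIV)
qed

definition extension :: "'a beta measure" where
  "extension = measure_of UNIV (sets borel) outer"

lemma sets_extension: "sets extension = sets borel"
  unfolding extension_def using sets.sigma_sets_eq[of "borel :: 'a beta measure"] by simp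

lemma emeasure_extension:
  assumes "B \<in> sets borel"
  shows "emeasure extension B = outer B"
proof -
  let ?L = "lambda_system UNIV (Pow (UNIV :: 'a beta set)) outer"
  interpret sigma_algebra UNIV "Pow (UNIV :: 'a beta set)" by (rule sigma_algebra_Pow)
  have L: "measure_space UNIV ?L outer"
    by (rule caratheodory_lemma[OF outer_measure_space_outer])
  then interpret L: sigma_algebra UNIV ?L by (simp add: measure_space_def)
  have "sigma_sets UNIV {S :: 'a beta set. open S} \<subseteq> ?L"
    by (rule L.sigma_sets_subset) (use open_in_lambda_system in blast)
  then have sub: "sets (borel :: 'a beta measure) \<subseteq> ?L"
    by (simp add: borel_def)
  have "sigma_algebra UNIV (sets (borel :: 'a beta measure))"
    using sets.sigma_algebra_axioms[of "borel :: 'a beta measure"] by simp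
  moreover have "positive (sets borel) outer" "countably_additive (sets borel) outer"
    using L sub by (auto simp: measure_space_def positive_def countably_additive_def)
  ultimately show ?thesis
    unfolding extension_def using assms by (rule emeasure_measure_of_sigma)
qed

lemma emeasure_extension_bar: "emeasure extension (bar A) = m A"
  by (simp add: emeasure_extension borel_open open_bar outer_open inner_bar)

text \<open>Inner regularity by compact sets is outer regularity of the complement, since the total
  mass is finite and closed sets are compact.\<close>

lemma radon_extension: "radon_measure extension"
  unfolding radon_measure_def
proof (intro conjI allI ballI)
  show "sets extension = sets borel" by (rule sets_extension)
next
  fix x
  show "\<exists>U. open U \<and> x \<in> U \<and> emeasure extension U < \<infinity>"
    using outer_finite[of UNIV]
    by (intro exI[of _ UNIV]) (simp add: emeasure_extension less_top)
next
  fix B :: "'a beta set"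
  assume B: "B \<in> sets borel"
  show "emeasure extension B = (SUP K\<in>{K. compact K \<and> K \<subseteq> B}. emeasure extension K)"
  proof (rule antisym)
    show "(SUP K\<in>{K. compact K \<and> K \<subseteq> B}. emeasure extension K) \<le> emeasure extension B"
      using B by (auto intro!: SUP_least emeasure_mono simp: sets_extension)
    show "emeasure extension B \<le> (SUP K\<in>{K. compact K \<and> K \<subseteq> B}. emeasure extension K)"
      (is "_ \<le> ?s")
    proof (rule ennreal_le_epsilon)
      fix e :: real assume "0 < e"
      then obtain U where U: "open U" "- B \<subseteq> U" "inner U \<le> outer (- B) + ennreal e"
        by (rule outer_approx)
      have meas: "B \<in> sets extension" "- B \<in> sets extension" "U \<in> sets extension"
        "- U \<in> sets extension"
        using B U(1) by (auto simp: sets_extension borel_open intro: borel_comp)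
      have total: "emeasure extension C + emeasure extension (- C) = emeasure extension UNIV"
        if "C \<in> sets extension" "- C \<in> sets extension" for C
        using plus_emeasure[OF that] by simp
      have "compact (- U)" using U(1) by (intro closed_imp_compact_beta) (simp add: closed_def)
      then have "emeasure extension (- U) \<le> ?s" using U(2) by (intro SUP_upper) auto
      have "emeasure extension (- B) + emeasure extension B
          = emeasure extension U + emeasure extension (- U)"
        using total[OF meas(1,2)] total[OF meas(3,4)] by (simp add: add.commute)
      also have "\<dots> \<le> (emeasure extension (- B) + ennreal e) + ?s"
        using U \<open>emeasure extension (- U) \<le> ?s\<close> meas
        by (intro add_mono) (simp_all add: emeasure_extension outer_open sets_extension)
      finally have "emeasure extension (- B) + emeasure extension B
          \<le> emeasure extension (- B) + (?s + ennreal e)"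
        by (simp add: ac_simps)
      moreover have "emeasure extension (- B) \<noteq> top"
        using meas outer_finite by (simp add: emeasure_extension sets_extension)
      ultimately show "emeasure extension B \<le> ?s + ennreal e"
        by (simp add: ennreal_add_left_cancel_le)
    qed
  qed
qed

end

section \<open>Window densities along ultrafilters\<close>

lemma window_density_le_1: "window_density A N M \<le> 1"
proof -
  have "card (A \<inter> {M + 1..M + N}) \<le> card {M + 1..M + N}" by (intro card_mono) auto
  then show ?thesis by (cases "N = 0") (auto simp: window_density_def)
qed

lemma window_density_nonneg: "0 \<le> window_density A N M"
  by (simp add: window_density_def)

lemma window_density_Un:
  assumes "A \<inter> B = {}"
  shows "window_density (A \<union> B) N M = window_density A N M + window_density B N M"
proof -
  have "card ((A \<union> B) \<inter> {M + 1..M + N})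
      = card (A \<inter> {M + 1..M + N}) + card (B \<inter> {M + 1..M + N})"
    using assms by (subst card_Un_disjoint[symmetric]) (auto simp: Int_Un_distrib2)
  then show ?thesis by (simp add: window_density_def add_divide_distrib)
qed

text \<open>Limits of window densities along any ultrafilter are finitely additive, so the extension
  above turns them into a Radon measure.\<close>

lemma ex_radon_measure_window_density:
  obtains \<mu> where "radon_measure \<mu>"
    "\<And>A. ((\<lambda>(N, M). ennreal (window_density A N M)) \<longlongrightarrow> emeasure \<mu> (bar A)) (filter_of q)"
    "emeasure \<mu> UNIV \<noteq> top"
proof -
  have "\<exists>l. ((\<lambda>(N, M). ennreal (window_density A N M)) \<longlongrightarrow> ennreal l) (filter_of q)" for A
  proof -
    have "\<exists>l\<in>{0..1}. ((\<lambda>(N, M). window_density A N M) \<longlongrightarrow> l) (filter_of q)"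
      by (rule compact_tendsto_along_ultrafilter)
        (auto simp: window_density_nonneg window_density_le_1)
    then show ?thesis by (auto dest!: tendsto_ennrealI simp: case_prod_unfold)
  qed
  then obtain l where l:
    "\<And>A. ((\<lambda>(N, M). ennreal (window_density A N M)) \<longlongrightarrow> ennreal (l A)) (filter_of q)"
    by metis
  interpret finite_content "\<lambda>A. ennreal (l A)"
  proof
    fix A B :: "nat set" assume "A \<inter> B = {}"
    then have "((\<lambda>(N, M). ennreal (window_density (A \<union> B) N M)) \<longlongrightarrow> ennreal (l A) + ennreal (l B))
        (filter_of q)"
      using tendsto_add[OF l[of A] l[of B]]
      by (simp add: window_density_Un window_density_nonneg case_prod_unfold)
    then show "ennreal (l (A \<union> B)) = ennreal (l A) + ennreal (l B)"
      by (rule tendsto_unique[OF filter_of_neq_bot l])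
  qed simp
  show thesis
  proof (rule that)
    show "radon_measure extension" by (rule radon_extension)
    show "((\<lambda>(N, M). ennreal (window_density A N M)) \<longlongrightarrow> emeasure extension (bar A))
        (filter_of q)" for A
      unfolding emeasure_extension_bar by (rule l)
    show "emeasure extension UNIV \<noteq> top"
      using emeasure_extension_bar[of UNIV] by (simp add: bar_UNIV)
  qed
qed

text \<open>The bound on the densities of long windows is uniform in the position of the window, so
  only the lengths have to tend to infinity along the ultrafilter.\<close>

lemma window_density_tendsto_0:
  assumes A: "\<not> 0 < upper_banach_density A" and q: "counting_ultrafilter q"
  shows "((\<lambda>(N, M). ennreal (window_density A N M)) \<longlongrightarrow> 0) (filter_of q)"
proof -
  have long: "\<forall>\<^sub>F (N, M) in filter_of q. n \<le> N" for n
  proof -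
    have "\<forall>\<^sub>F (N, M) in filter_of q. 1 / real N < 1 / real (Suc n)"
      using q order_tendstoD(2)[of "\<lambda>(N, M). 1 / real N" 0 "filter_of q" "1 / real (Suc n)"]
      by (simp add: counting_ultrafilter_def case_prod_unfold)
    moreover have "\<forall>\<^sub>F (N, M) in filter_of q. 0 < N"
      using q by (simp add: counting_ultrafilter_def mem_uf_def case_prod_unfold)
    ultimately show ?thesis
      by eventually_elim (auto simp: field_simps)
  qed
  have "((\<lambda>(N, M). window_density A N M) \<longlongrightarrow> 0) (filter_of q)"
  proof (rule order_tendstoI)
    fix e :: real assume "e < 0"
    then show "\<forall>\<^sub>F x in filter_of q. e < (case x of (N, M) \<Rightarrow> window_density A N M)"
      using less_le_trans[OF _ window_density_nonneg] by (simp add: case_prod_unfold)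
  next
    fix e :: real assume "0 < e"
    with A have "limsup (\<lambda>N. SUP M. ereal (window_density A N M)) < ereal e"
      by (auto simp: upper_banach_density_def not_less elim: le_less_trans)
    then have "\<forall>\<^sub>F N in sequentially. (SUP M. ereal (window_density A N M)) < ereal e"
      by (rule Limsup_lessD)
    then obtain n where n: "\<And>N. n \<le> N \<Longrightarrow> (SUP M. ereal (window_density A N M)) < ereal e"
      by (auto simp: eventually_sequentially)
    have "window_density A N M < e" if "n \<le> N" for N M
      using SUP_lessD[OF n[OF that], of M] by simp
    with long[of n] show "\<forall>\<^sub>F x in filter_of q. (case x of (N, M) \<Rightarrow> window_density A N M) < e"
      by (auto elim!: eventually_mono)
  qed
  from tendsto_ennrealI[OF this] show ?thesis by (simp add: case_prod_unfold)
qed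

lemma long_dense_windows:
  assumes "ereal c < upper_banach_density A"
  shows "\<exists>N\<ge>n. \<exists>M. c < window_density A N M"
proof (rule ccontr)
  assume "\<not> ?thesis"
  then have "(SUP M. ereal (window_density A N M)) \<le> ereal c" if "n \<le> N" for N
    using that by (auto intro!: SUP_least simp: not_less)
  then have "upper_banach_density A \<le> ereal c"
    unfolding upper_banach_density_def
    by (intro Limsup_bounded) (auto simp: eventually_sequentially)
  with assms show False by simp
qed

text \<open>Take a window of density above \<open>c\<close> and cut off its part up to \<open>L + 1\<close>. This loses at most
  \<open>L + 1\<close> elements of \<open>A\<close>, which is less than half of them if the window is long, and it does
  not lengthen the window. The remaining window starts late and still has density at least \<open>c / 2\<close>.\<close>

lemma late_long_dense_windows:
  assumes c: "0 < c" "ereal c < upper_banach_density A"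
  shows "\<exists>N M. L < M \<and> L < N \<and> c / 2 \<le> window_density A N M"
proof -
  \<comment> \<open>Windows of this length have more than \<open>2 * (L + 2)\<close> elements of \<open>A\<close>, so a loss of \<open>L + 1\<close>
    leaves more than half of them, and more than \<open>L\<close>.\<close>
  define n where "n = nat \<lceil>2 * real (L + 2) / c\<rceil>"
  obtain N M where N: "n \<le> N" and dens: "c < window_density A N M"
    using long_dense_windows[OF c(2), of n] by blast
  have "2 * real (L + 2) / c \<le> real N" using N unfolding n_def by linarith
  then have big: "2 * real (L + 2) \<le> c * real N" using c(1) by (simp add: field_simps)
  then have "0 < N" using c(1) by (cases "N = 0") auto
  then have count: "c * real N < real (card (A \<inter> {M + 1..M + N}))"
    using dens by (simp add: window_density_def field_simps)
  define M' where "M' = max M (L + 1)"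
  define N' where "N' = M + N - M'"
  define d where "d = card (A \<inter> {M' + 1..M' + N'})"
  have "A \<inter> {M + 1..M + N} \<subseteq> {M + 1..M'} \<union> (A \<inter> {M' + 1..M' + N'})"
    by (auto simp: N'_def)
  then have "card (A \<inter> {M + 1..M + N}) \<le> card ({M + 1..M'} \<union> (A \<inter> {M' + 1..M' + N'}))"
    by (intro card_mono) auto
  also have "\<dots> \<le> card {M + 1..M'} + d" unfolding d_def by (rule card_Un_le)
  also have "\<dots> \<le> L + 1 + d" by (simp add: M'_def)
  finally have "real (card (A \<inter> {M + 1..M + N})) \<le> real (L + 1 + d)" by (rule of_nat_mono)
  then have d: "c * real N / 2 < real d" using count big by simp
  have "d \<le> card {M' + 1..M' + N'}" unfolding d_def by (intro card_mono) auto
  then have "d \<le> N'" by simp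
  moreover have "L < d"
  proof -
    have "real (L + 2) < real d" using d big by simp
    then show ?thesis by simp
  qed
  ultimately have "L < N'" by simp
  have "c / 2 * real N' \<le> c / 2 * real N"
    using c(1) by (intro mult_left_mono) (auto simp: N'_def M'_def)
  also have "\<dots> \<le> real d" using d by simp
  finally have "c / 2 \<le> window_density A N' M'"
    using \<open>L < N'\<close> unfolding window_density_def d_def[symmetric] by (simp add: field_simps)
  moreover have "L < M'" by (simp add: M'_def)
  ultimately show ?thesis using \<open>L < N'\<close> by blast
qed

lemma ex_disjoint_growing_dense_windows:
  assumes c: "0 < c" "ereal c < upper_banach_density A"
  obtains N M :: "nat \<Rightarrow> nat" where
    "\<And>i. 0 < N i \<and> M i + N i < M (Suc i) \<and> N i < N (Suc i)"
    "\<And>i. c / 2 \<le> window_density A (N i) (M i)"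
proof -
  let ?P = "\<lambda>w. 0 < fst w \<and> c / 2 \<le> window_density A (fst w) (snd w)"
  let ?Q = "\<lambda>v w. snd v + fst v < snd w \<and> fst v < fst w"
  have "\<exists>f. \<forall>i. ?P (f i) \<and> ?Q (f i) (f (Suc i))"
  proof (rule dependent_nat_choice)
    show "\<exists>w. ?P w"
      using late_long_dense_windows[OF c, of 0] by auto
  next
    fix v :: "nat \<times> nat" and i :: nat
    obtain N M where "snd v + fst v < M" "snd v + fst v < N" "c / 2 \<le> window_density A N M"
      using late_long_dense_windows[OF c, of "snd v + fst v"] by blast
    then show "\<exists>w. ?P w \<and> ?Q v w" by (intro exI[of _ "(N, M)"]) auto
  qed
  then obtain f where "\<And>i. ?P (f i) \<and> ?Q (f i) (f (Suc i))" by blast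
  then show thesis by (intro that[of "\<lambda>i. fst (f i)" "\<lambda>i. snd (f i)"]) auto
qed

lemma ex_counting_ultrafilter_dense:
  assumes c: "0 < c" "ereal c < upper_banach_density A"
  obtains q where "counting_ultrafilter q"
    "\<forall>\<^sub>F (N, M) in filter_of q. c / 2 \<le> window_density A N M"
proof -
  obtain N M :: "nat \<Rightarrow> nat" where
    NM: "\<And>i. 0 < N i \<and> M i + N i < M (Suc i) \<and> N i < N (Suc i)"
    and dens: "\<And>i. c / 2 \<le> window_density A (N i) (M i)"
    using ex_disjoint_growing_dense_windows[OF c] by blast
  let ?w = "\<lambda>i. (N i, M i)"
  have "filtermap ?w sequentially \<noteq> bot" by (simp add: filtermap_bot_iff)
  then obtain q where q: "filter_of q \<le> filtermap ?w sequentially" by (rule ultrafilter_below)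
  have ev: "eventually P (filter_of q)" if "\<And>i. P (?w i)" for P
    using that by (intro filter_leD[OF q]) (simp add: eventually_filtermap)
  have "((\<lambda>i. 1 / real (N i)) \<longlongrightarrow> 0) sequentially"
  proof -
    have "strict_mono N" using NM by (simp add: strict_mono_Suc_iff)
    then have "((\<lambda>n. 1 / real n) \<circ> N) \<longlonglongrightarrow> 0"
      by (rule LIMSEQ_subseq_LIMSEQ[OF lim_const_over_n])
    then show ?thesis by (simp add: o_def)
  qed
  then have "((\<lambda>(N, M). 1 / real N) \<longlongrightarrow> 0) (filtermap ?w sequentially)"
    by (simp add: filterlim_filtermap)
  then have "((\<lambda>(N, M). 1 / real N) \<longlongrightarrow> 0) (filter_of q)"
    by (rule filterlim_mono[OF _ order_refl q])
  moreover have "disjoint_growing (range ?w)"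
    unfolding disjoint_growing_def using NM by blast
  moreover have "q \<in> bar (range ?w)"
    unfolding bar_def mem_uf_def by (auto intro: ev)
  moreover have "mem_uf {(N, M). 0 < N} q"
    unfolding mem_uf_def using NM by (auto intro: ev)
  ultimately have "counting_ultrafilter q" by (auto simp: counting_ultrafilter_def)
  moreover have "\<forall>\<^sub>F (N, M) in filter_of q. c / 2 \<le> window_density A N M"
    using dens by (auto intro: ev)
  ultimately show thesis by (rule that)
qed

section \<open>Szemeredi's theorem and counting measures\<close>

lemma Compl_AP: "- AP k = (\<Union>A\<in>{A. \<not> contains_arith_prog k A}. bar A)"
  by (auto simp: AP_def bar_def)

text \<open>A union of null open sets need not be null for a general measure; here a compact subset
  is covered by finitely many of them, and the measure is inner regular.\<close>

lemma radon_measure_UN_null: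
  assumes \<mu>: "radon_measure \<mu>" and op: "\<And>i. i \<in> I \<Longrightarrow> open (U i)"
    and null: "\<And>i. i \<in> I \<Longrightarrow> emeasure \<mu> (U i) = 0"
  shows "emeasure \<mu> (\<Union>i\<in>I. U i) = 0"
proof -
  have sets: "sets \<mu> = sets borel" using \<mu> by (simp add: radon_measure_def)
  have "emeasure \<mu> K \<le> 0" if K: "compact K" "K \<subseteq> (\<Union>i\<in>I. U i)" for K
  proof -
    obtain J where J: "J \<subseteq> I" "finite J" "K \<subseteq> (\<Union>i\<in>J. U i)"
      using compactE_image[OF K(1) op K(2)] by blast
    have meas: "U i \<in> sets \<mu>" if "i \<in> J" for i
      using that J(1) op by (auto simp: sets intro: borel_open)
    have "emeasure \<mu> K \<le> emeasure \<mu> (\<Union>i\<in>J. U i)"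
      using J(2,3) meas by (intro emeasure_mono sets.finite_UN) auto
    also have "\<dots> \<le> (\<Sum>i\<in>J. emeasure \<mu> (U i))"
      using J(2) meas by (intro emeasure_subadditive_finite) auto
    also have "\<dots> = 0" using J(1) null by (intro sum.neutral) blast
    finally show ?thesis .
  qed
  moreover have "(\<Union>i\<in>I. U i) \<in> sets borel" using op by (intro borel_open open_UN) auto
  ultimately show ?thesis
    using \<mu> unfolding radon_measure_def by (auto simp: SUP_eq_iff bot_ennreal intro!: antisym SUP_least)
qed

lemma emeasure_AP_eq_UNIV:
  assumes sz: "\<And>A. 0 < upper_banach_density A \<Longrightarrow> contains_arith_prog k A"
    and \<mu>: "counting_measure \<mu>"
  shows "emeasure \<mu> (AP k) = emeasure \<mu> UNIV"
proof -
  obtain q where q: "counting_ultrafilter q"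
    and lim: "\<And>A. ((\<lambda>(N, M). ennreal (window_density A N M)) \<longlongrightarrow> emeasure \<mu> (bar A)) (filter_of q)"
    and R: "radon_measure \<mu>"
    using \<mu> by (auto simp: counting_measure_def)
  have "emeasure \<mu> (bar A) = 0" if "\<not> contains_arith_prog k A" for A
    using that sz[of A]
    by (intro tendsto_unique[OF filter_of_neq_bot lim window_density_tendsto_0[OF _ q]]) blast
  then have "emeasure \<mu> (- AP k) = 0"
    unfolding Compl_AP by (intro radon_measure_UN_null[OF R] open_bar) auto
  moreover have "AP k \<in> sets \<mu>" "- AP k \<in> sets \<mu>"
    using R AP_in_borel[of k] by (auto simp: radon_measure_def intro: borel_comp)
  ultimately show ?thesis
    using plus_emeasure[of "AP k" \<mu> "- AP k"] by simp
qed

lemma contains_arith_prog_if_dense: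
  assumes full: "\<And>\<mu>. counting_measure \<mu> \<Longrightarrow> emeasure \<mu> (AP k) = emeasure \<mu> UNIV"
    and A: "0 < upper_banach_density A"
  shows "contains_arith_prog k A"
proof -
  obtain c where c: "0 < c" "ereal c < upper_banach_density A"
    using ereal_dense2[OF A] by auto
  obtain q where q: "counting_ultrafilter q"
    and dens: "\<forall>\<^sub>F (N, M) in filter_of q. c / 2 \<le> window_density A N M"
    using ex_counting_ultrafilter_dense[OF c] by blast
  obtain \<mu> where R: "radon_measure \<mu>" and fin: "emeasure \<mu> UNIV \<noteq> top"
    and lim: "\<And>A. ((\<lambda>(N, M). ennreal (window_density A N M)) \<longlongrightarrow> emeasure \<mu> (bar A)) (filter_of q)"
    using ex_radon_measure_window_density[of q] by blast
  have "\<forall>\<^sub>F x in filter_of q. ennreal (c / 2) \<le> (case x of (N, M) \<Rightarrow> ennreal (window_density A N M))"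
    using dens by eventually_elim (auto intro: ennreal_leI)
  then have "ennreal (c / 2) \<le> emeasure \<mu> (bar A)"
    by (rule tendsto_lowerbound[OF lim _ filter_of_neq_bot])
  then have pos: "emeasure \<mu> (bar A) \<noteq> 0"
    using c(1) by auto
  have meas: "AP k \<in> sets \<mu>" "- AP k \<in> sets \<mu>"
    using R AP_in_borel[of k] by (auto simp: radon_measure_def intro: borel_comp)
  have "counting_measure \<mu>" using R q lim by (auto simp: counting_measure_def)
  then have "emeasure \<mu> UNIV + emeasure \<mu> (- AP k) = emeasure \<mu> UNIV"
    using full plus_emeasure[of "AP k" \<mu> "- AP k"] meas by simp
  then have "emeasure \<mu> (- AP k) = 0"
    using fin ennreal_add_left_cancel[of "emeasure \<mu> UNIV" "emeasure \<mu> (- AP k)" 0] by simp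
  with pos have "\<not> bar A \<subseteq> - AP k"
    using emeasure_mono[of "bar A" "- AP k" \<mu>] meas by auto
  then show ?thesis by (auto simp: AP_def bar_def)
qed

theorem theorem4p3p3:
  fixes k :: nat
  assumes "k > 0"
  shows "(\<forall>A. upper_banach_density A > 0 \<longrightarrow> contains_arith_prog k A) \<longleftrightarrow>
         (\<forall>\<mu>. counting_measure \<mu> \<longrightarrow> emeasure \<mu> (AP k) = emeasure \<mu> UNIV)"
proof (intro iffI allI impI)
  fix \<mu> :: "nat beta measure"
  assume "\<forall>A. upper_banach_density A > 0 \<longrightarrow> contains_arith_prog k A" "counting_measure \<mu>"
  then show "emeasure \<mu> (AP k) = emeasure \<mu> UNIV"
    by (intro emeasure_AP_eq_UNIV) simp_all
next
  fix A
  assume "\<forall>\<mu>. counting_measure \<mu> \<longrightarrow> emeasure \<mu> (AP k) = emeasure \<mu> UNIV"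
    "upper_banach_density A > 0"
  then show "contains_arith_prog k A"
    by (intro contains_arith_prog_if_dense) simp_all
qed

end
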